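(* Let $N>1$ and $K\ge 1$ be integers, let $\omega\in\mathbb{R}$, let $\boldsymbol{n}_1,\dots,\boldsymbol{n}_K\in\mathbb{R}^N$ be arbitrary vectors and let $\phi_1,\dots,\phi_K\in\mathbb{R}$ be arbitrary phases. Define the signal $f:\mathbb{R}\to\mathbb{R}^N$ by $$f(t)=\sum_{i=1}^{K}\boldsymbol{n}_i\sin(\omega t+\phi_i).$$ Then for all $t\in\mathbb{R}$, $$f(t)=\boldsymbol{c}\sin(\omega t)+\boldsymbol{s}\cos(\omega t),$$ where $$\boldsymbol{c}=\sum_{i=1}^{K}\boldsymbol{n}_i\cos\phi_i,\qquad \boldsymbol{s}=\sum_{i=1}^{K}\boldsymbol{n}_i\sin\phi_i .$$ Consequently $f$ always lies within a plane in $\mathbb{R}^N$, i.e. there is a two-dimensional linear subspace of $\mathbb{R}^N$ containing $f(t)$ for all $t\in\mathbb{R}$.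
   Context: A sinusoidal signal in $N$ dimensions is a function $t\mapsto \boldsymbol{n}\sin(\omega t+\phi)$ with $\boldsymbol{n}\in\mathbb{R}^N$ (not necessarily a unit vector; its length is the amplitude and its direction the direction of oscillation), angular frequency $\omega\in\mathbb{R}$ and initial phase $\phi\in\mathbb{R}$. The theorem concerns a sum of $K$ such signals sharing the same angular frequency $\omega$. *)

theory Defs
  imports "HOL-Analysis.Analysis"
begin

end

theory Submission
  imports Defs
begin

text \<open>
  The angle addition formula for the sine splits each summand into a multiple of
  \<open>sin (\<omega> * t)\<close> and a multiple of \<open>cos (\<omega> * t)\<close>; because the frequency is shared, the
  two scalar functions of \<open>t\<close> factor out of the sum and leave the constant vectors \<open>c\<close> and \<open>s\<close>.
  Every value of the signal therefore lies in \<open>span {c, s}\<close>.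

  This span can have dimension less than two: it is a line if the signal oscillates in one
  direction only, and zero if the summands cancel. To obtain a genuine plane, the span is
  enlarged inside the ambient space, which has room for it by \<open>subspace_of_dim_superset\<close>.
\<close>

text \<open>
  Adjoining a vector outside a proper subspace raises the dimension by exactly one, so every
  dimension between that of \<open>S\<close> and that of the whole space is attained above \<open>S\<close>.
\<close>

lemma subspace_of_dim_superset:
  fixes S :: "'a::euclidean_space set"
  assumes "dim S \<le> d" and "d \<le> DIM('a)"
  obtains T where "subspace T" "S \<subseteq> T" "dim T = d"
proof -
  have "\<exists>T. subspace T \<and> S \<subseteq> T \<and> dim T = d"
    using assms
  proof (induction d rule: dec_induct)
    case base
    show ?case
      by (intro exI[of _ "span S"]) (simp add: span_superset)
  next
    case (step m)
    then obtain T where T: "subspace T" "S \<subseteq> T" "dim T = m"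
      by auto
    with step.prems have "span T \<noteq> UNIV"
      by (metis dim_UNIV dim_span not_less_eq_eq order_refl)
    then obtain x where "x \<notin> span T"
      by blast
    with T have "dim (span (insert x T)) = Suc m"
      by (simp add: dim_insert)
    moreover have "S \<subseteq> span (insert x T)"
      using T(2) span_superset by blast
    ultimately show ?case
      using subspace_span by blast
  qed
  then show thesis
    using that by blast
qed

lemma sum_sinusoids_same_frequency:
  fixes n :: "'i \<Rightarrow> 'a::real_vector" and \<phi> :: "'i \<Rightarrow> real"
  shows "(\<Sum>i\<in>I. sin (x + \<phi> i) *\<^sub>R n i) =
    sin x *\<^sub>R (\<Sum>i\<in>I. cos (\<phi> i) *\<^sub>R n i) + cos x *\<^sub>R (\<Sum>i\<in>I. sin (\<phi> i) *\<^sub>R n i)"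
  by (simp add: sin_add scaleR_add_left sum.distrib scaleR_sum_right)

theorem theorem1:
  fixes n :: "nat \<Rightarrow> real ^ 'n"
    and \<phi> :: "nat \<Rightarrow> real"
    and \<omega> :: real
    and K :: nat
    and f :: "real \<Rightarrow> real ^ 'n"
    and c s :: "real ^ 'n"
  assumes "CARD('n) > 1"
    and "K \<ge> 1"
    and "f = (\<lambda>t. \<Sum>i = 1..K. sin (\<omega> * t + \<phi> i) *\<^sub>R n i)"
    and "c = (\<Sum>i = 1..K. cos (\<phi> i) *\<^sub>R n i)"
    and "s = (\<Sum>i = 1..K. sin (\<phi> i) *\<^sub>R n i)"
  shows "(\<forall>t. f t = sin (\<omega> * t) *\<^sub>R c + cos (\<omega> * t) *\<^sub>R s) \<and>
         (\<exists>P. subspace P \<and> dim P = 2 \<and> (\<forall>t. f t \<in> P))"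
proof -
  have f_eq: "f t = sin (\<omega> * t) *\<^sub>R c + cos (\<omega> * t) *\<^sub>R s" for t
    unfolding assms(3-5) by (rule sum_sinusoids_same_frequency)
  have "dim {c, s} \<le> card {c, s}"
    by (intro dim_le_card span_superset) simp
  also have "\<dots> \<le> 2"
    by (simp add: card_insert_if)
  finally have "dim {c, s} \<le> 2" .
  moreover have "2 \<le> DIM(real ^ 'n)"
    using assms(1) by simp
  ultimately obtain P where P: "subspace P" "{c, s} \<subseteq> P" "dim P = 2"
    by (rule subspace_of_dim_superset)
  then have "f t \<in> P" for t
    by (simp add: f_eq subspace_add subspace_scale)
  with P f_eq show ?thesis
    by blast
qed

end
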